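(* Let $\mathcal{K}$ be a conditionally complete idempotent semifield without a top element, with completed semiring $\overline{\mathcal{K}}$, and let $n\ge1$. Let $U$ be the set of differences of affine functions, i.e., of functions $u:\mathcal{K}^n\to\mathcal{K}$ of the form $u(x)=(\langle w',x\rangle\oplus d')\ominus(\langle w'',x\rangle\oplus d'')$ with $w',w''\in\mathcal{K}^n$ and $d',d''\in\mathcal{K}$. A function $f:\mathcal{K}^n\to\overline{\mathcal{K}}$ is convex and lower semi-continuous if, and only if, it is a sup of differences of affine functions, i.e., a $U$-convex function: there is a subset $U'\subset U$ such that $f(x)=\sup_{u\in U'}u(x)$ for all $x\in\mathcal{K}^n$.
   Context: An idempotent semiring is a semiring $(\mathcal{S},\oplus,\otimes)$ with zero $\mathbf{0}$ (neutral for $\oplus$, absorbing) and unit $\mathbf{1}$ such that $a\oplus a=a$. Its natural order is $a\le b\iff a\oplus b=b$, so $a\oplus b=a\vee b$ and $\mathbf{0}$ is the bottom element. An idempotent semifield is an idempotent semiring whose nonzero elements are invertible for multiplication. An ordered set is conditionally complete if every nonempty subset bounded above has a least upper bound and every nonempty subset bounded below has a greatest lower bound. An idempotent semifield $\mathcal{K}$ is conditionally complete if it is so for its natural order and left and right multiplications by any element preserve sups of nonempty sets bounded above. The completed semiring $\overline{\mathcal{K}}$ is obtained by adjoining to $\mathcal{K}$ a top element $\tau$ with $a\oplus\tau=\tau$, $\mathbf{0}\tau=\tau\mathbf{0}=\mathbf{0}$, and $a\tau=\tau a=\tau$ for $a\ne\mathbf{0}$. Sups are taken in $\overline{\mathcal{K}}$.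 $\mathcal{K}^n$ and $\mathcal{K}^n\times\mathcal{K}$ have entrywise addition, order and right action of $\mathcal{K}$; $\langle w,x\rangle=\bigoplus_{1\le i\le n}w_ix_i$. For $\nu,\lambda\in\mathcal{K}$, $\nu\ominus\lambda$ is the least $\mu$ such that $\lambda\oplus\mu\ge\nu$ (it exists). A subset $C$ of $\mathcal{K}^m$ is convex if $x\alpha\oplus y\beta\in C$ for all $x,y\in C$, $\alpha,\beta\in\mathcal{K}$ with $\alpha\oplus\beta=\mathbf{1}$. A function $f:\mathcal{K}^n\to\overline{\mathcal{K}}$ is convex if its epigraph $\{(x,\lambda)\in\mathcal{K}^n\times\mathcal{K}\mid f(x)\le\lambda\}$ is convex. It is lower semi-continuous if all its lower level sets $\{x\in\mathcal{K}^n\mid f(x)\le t\}$, $t\in\overline{\mathcal{K}}$, are closed in the order topology of $\mathcal{K}^n$. Order topology: a net $(x_\ell)_{\ell\in L}$ in a conditionally complete ordered set $S$, bounded from above and below, order converges to $x\in S$ if $x=\inf_{\ell}\sup_{m\ge\ell}x_m=\sup_{\ell}\inf_{m\ge\ell}x_m$. A subset $X\subset S$ is closed for the order topology if the limit of every order converging net with values in $X$ belongs to $X$.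
   Formalization: The existence of the least μ with λ⊕μ≥ν (so that ν⊖λ is defined) for all ν, λ is assumed as a hypothesis; it fails in general (e.g. Z² with a bottom adjoined) and holds exactly when K is totally ordered. *)

theory Defs
  imports Complex_Main "HOL-Library.Function_Algebras" "HOL-Library.Product_Plus"
begin

section \<open>Idempotent semirings and semifields\<close>

text \<open>Multiplication is not assumed commutative. The order is the natural one.\<close>

class idempotent_semiring = semiring_1 + ord +
  assumes add_idem: "a + a = a"
    and natural_le: "a \<le> b \<longleftrightarrow> a + b = b"
    and natural_less: "a < b \<longleftrightarrow> a \<le> b \<and> a \<noteq> b"
begin

subclass order
proof
  fix a b c
  show "a < b \<longleftrightarrow> a \<le> b \<and> \<not> b \<le> a"
    by (metis add.commute natural_le natural_less)
  show "a \<le> a" by (simp add: natural_le add_idem)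
  show "a \<le> b \<Longrightarrow> b \<le> c \<Longrightarrow> a \<le> c" by (metis natural_le add.assoc)
  show "a \<le> b \<Longrightarrow> b \<le> a \<Longrightarrow> a = b" by (metis natural_le add.commute)
qed

lemma zero_least: "0 \<le> a"
  by (simp add: natural_le)

lemma add_eq_zero_iff: "a + b = 0 \<longleftrightarrow> a = 0 \<and> b = 0"
  by (metis add.assoc add.commute add_0_left add_idem)

end

class idempotent_semifield = idempotent_semiring +
  assumes ex_inverse: "a \<noteq> 0 \<Longrightarrow> \<exists>b. a * b = 1 \<and> b * a = 1"
begin

lemma mult_eq_zero_iff: "a * b = 0 \<longleftrightarrow> a = 0 \<or> b = 0"
  by (metis ex_inverse mult.assoc mult_1_left mult_zero_left mult_zero_right)

end

class cond_complete_idempotent_semifield = idempotent_semifield + conditionally_complete_lattice +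
  assumes mult_cSup_left: "A \<noteq> {} \<Longrightarrow> bdd_above A \<Longrightarrow> a * Sup A = Sup ((\<lambda>x. a * x) ` A)"
    and mult_cSup_right: "A \<noteq> {} \<Longrightarrow> bdd_above A \<Longrightarrow> Sup A * a = Sup ((\<lambda>x. x * a) ` A)"


section \<open>The completed semiring\<close>

datatype 'k completed = Elt 'k | Tau

instantiation completed :: (order) order
begin

definition less_eq_completed :: "'a completed \<Rightarrow> 'a completed \<Rightarrow> bool" where
  "x \<le> y \<longleftrightarrow> (case y of Tau \<Rightarrow> True | Elt b \<Rightarrow> (case x of Tau \<Rightarrow> False | Elt a \<Rightarrow> a \<le> b))"

definition less_completed :: "'a completed \<Rightarrow> 'a completed \<Rightarrow> bool" where
  "less_completed x y \<longleftrightarrow> x \<le> y \<and> \<not> y \<le> x"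

instance
  by standard (auto simp: less_eq_completed_def less_completed_def split: completed.splits)

end

lemma le_completed_simps [simp]:
  "Elt a \<le> Elt b \<longleftrightarrow> a \<le> b" "x \<le> Tau" "\<not> Tau \<le> Elt a"
  by (simp_all add: less_eq_completed_def split: completed.splits)

instantiation completed :: (idempotent_semifield) idempotent_semiring
begin

definition zero_completed :: "'a completed" where "0 = Elt 0"

definition one_completed :: "'a completed" where "1 = Elt 1"

definition plus_completed :: "'a completed \<Rightarrow> 'a completed \<Rightarrow> 'a completed" where
  "x + y = (case (x, y) of (Elt a, Elt b) \<Rightarrow> Elt (a + b) | _ \<Rightarrow> Tau)"

definition times_completed :: "'a completed \<Rightarrow> 'a completed \<Rightarrow> 'a completed" where
  "x * y = (case (x, y) of
      (Elt a, Elt b) \<Rightarrow> Elt (a * b)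
    | _ \<Rightarrow> if x = Elt 0 \<or> y = Elt 0 then Elt 0 else Tau)"

instance
proof
  fix a b c :: "'a completed"
  note defs = zero_completed_def one_completed_def plus_completed_def times_completed_def
  show "a + b + c = a + (b + c)" "a + b = b + a" "0 + a = a"
    "0 * a = 0" "a * 0 = 0" "1 * a = a" "a * 1 = a" "(0::'a completed) \<noteq> 1" "a + a = a"
    by (cases a; cases b; cases c; simp add: defs ac_simps add_idem; fail)+
  show "a * b * c = a * (b * c)" "(a + b) * c = a * c + b * c" "a * (b + c) = a * b + a * c"
    by (cases a; cases b; cases c;
        auto simp add: defs ac_simps add_eq_zero_iff mult_eq_zero_iff distrib_left distrib_right)+
  show "a \<le> b \<longleftrightarrow> a + b = b"
    by (cases a; cases b; simp add: defs natural_le)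
  show "a < b \<longleftrightarrow> a \<le> b \<and> a \<noteq> b" by (rule less_le)
qed

end

instantiation completed :: (cond_complete_idempotent_semifield) complete_lattice
begin

definition bot_completed :: "'a completed" where "bot = Elt 0"

definition top_completed :: "'a completed" where "top = Tau"

definition sup_completed :: "'a completed \<Rightarrow> 'a completed \<Rightarrow> 'a completed" where
  "sup_completed x y = x + y"

definition inf_completed :: "'a completed \<Rightarrow> 'a completed \<Rightarrow> 'a completed" where
  "inf_completed x y = (case (x, y) of (Elt a, Elt b) \<Rightarrow> Elt (inf a b) | (Tau, _) \<Rightarrow> y | (_, Tau) \<Rightarrow> x)"

definition Sup_completed :: "'a completed set \<Rightarrow> 'a completed" where
  "Sup_completed A = (if A \<subseteq> {Elt 0} then Elt 0
     else if Tau \<notin> A \<and> bdd_above {a. Elt a \<in> A} then Elt (Sup {a. Elt a \<in> A}) else Tau)"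

definition Inf_completed :: "'a completed set \<Rightarrow> 'a completed" where
  "Inf_completed A = (if A \<subseteq> {Tau} then Tau else Elt (Inf {a. Elt a \<in> A}))"

instance
proof
  fix x y z :: "'a completed" and A :: "'a completed set"
  have le0: "Elt 0 \<le> w" for w :: "'a completed"
    by (cases w) (simp_all add: zero_least)
  have bb: "bdd_below B" for B :: "'a set"
    by (rule bdd_belowI[of _ 0]) (rule zero_least)
  show "inf x y \<le> x" "inf x y \<le> y" "x \<le> y \<Longrightarrow> x \<le> z \<Longrightarrow> x \<le> inf y z"
    by (cases x; cases y; cases z; simp add: inf_completed_def; fail)+
  show "x \<le> sup x y"
    unfolding sup_completed_def natural_le by (metis add.assoc add_idem)
  show "y \<le> sup x y"
    unfolding sup_completed_def natural_le by (metis add.assoc add.commute add_idem)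
  show "y \<le> x \<Longrightarrow> z \<le> x \<Longrightarrow> sup y z \<le> x"
    unfolding sup_completed_def natural_le by (metis add.assoc)
  show "Inf A \<le> x" if "x \<in> A"
  proof (cases x)
    case (Elt a)
    then have "Inf {a. Elt a \<in> A} \<le> a" using that bb by (intro cInf_lower) auto
    then show ?thesis using Elt that by (auto simp: Inf_completed_def)
  qed simp
  show "z \<le> Inf A" if h: "\<And>x. x \<in> A \<Longrightarrow> z \<le> x"
  proof (cases "A \<subseteq> {Tau}")
    case False
    then obtain a where a: "Elt a \<in> A" by (metis completed.exhaust insertI1 subsetI)
    with h[OF a] obtain c where c: "z = Elt c" by (cases z) auto
    have "c \<le> Inf {a. Elt a \<in> A}"
      using a c h by (intro cInf_greatest) force+
    then show ?thesis using False c by (auto simp: Inf_completed_def)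
  qed (simp add: Inf_completed_def)
  show "x \<le> Sup A" if "x \<in> A"
  proof (cases x)
    case (Elt a)
    show ?thesis
    proof (cases "Tau \<notin> A \<and> bdd_above {a. Elt a \<in> A}")
      case True
      then have "a \<le> Sup {a. Elt a \<in> A}" using that Elt by (intro cSup_upper) auto
      then show ?thesis using Elt True that by (auto simp: Sup_completed_def)
    qed (use that in \<open>auto simp: Sup_completed_def\<close>)
  qed (use that in \<open>auto simp: Sup_completed_def\<close>)
  show "Sup A \<le> z" if h: "\<And>x. x \<in> A \<Longrightarrow> x \<le> z"
  proof (cases z)
    case (Elt c)
    have T: "Tau \<notin> A" using h Elt by fastforce
    have u: "a \<le> c" if "Elt a \<in> A" for a using h[OF that] Elt by simp
    then have b: "bdd_above {a. Elt a \<in> A}" by (auto intro!: bdd_aboveI[of _ c])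
    show ?thesis
    proof (cases "A \<subseteq> {Elt 0}")
      case False
      then obtain y where "y \<in> A" by auto
      with T obtain a where "Elt a \<in> A" by (cases y) auto
      then have "Sup {a. Elt a \<in> A} \<le> c" using u by (intro cSup_least) auto
      then show ?thesis using False T b Elt by (auto simp: Sup_completed_def)
    qed (use le0 in \<open>simp add: Sup_completed_def\<close>)
  qed simp
  show "Inf {} = (top :: 'a completed)" "Sup {} = (bot :: 'a completed)"
    by (simp_all add: Inf_completed_def Sup_completed_def top_completed_def bot_completed_def)
qed

end


section \<open>Differences of affine functions\<close>

text \<open>Vectors are functions on a finite index type, with the pointwise addition and order of the
  library.\<close>

definition inner_prod :: "('n::finite \<Rightarrow> 'k::idempotent_semiring) \<Rightarrow> ('n \<Rightarrow> 'k) \<Rightarrow> 'k" where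
  "inner_prod w x = (\<Sum>i\<in>UNIV. w i * x i)"

text \<open>The least element below need not exist in every conditionally complete idempotent semifield:
  in \<open>\<int>\<^sup>2\<close> with a bottom element adjoined, the elements \<open>\<mu>\<close> whose join with \<open>(0, 0)\<close> is above
  \<open>(1, 0)\<close> are the \<open>(a, b)\<close> with \<open>a \<ge> 1\<close> and \<open>b\<close> arbitrary. \<open>LEAST\<close> is then unspecified, so
  existence has to be a separate hypothesis.\<close>

definition ominus :: "'k::idempotent_semiring \<Rightarrow> 'k \<Rightarrow> 'k"  (infixl "\<ominus>" 65) where
  "\<nu> \<ominus> \<kappa> = (LEAST \<mu>. \<kappa> + \<mu> \<ge> \<nu>)"

definition affine_differences :: "(('n::finite \<Rightarrow> 'k::idempotent_semiring) \<Rightarrow> 'k) set" where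
  "affine_differences =
     {\<lambda>x. (inner_prod w' x + d') \<ominus> (inner_prod w'' x + d'') | w' w'' d' d''. True}"

definition U_convex ::
  "(('n \<Rightarrow> 'k) \<Rightarrow> 'k) set \<Rightarrow> (('n \<Rightarrow> 'k) \<Rightarrow> 'k::cond_complete_idempotent_semifield completed) \<Rightarrow> bool"
  where "U_convex U f \<longleftrightarrow> (\<exists>U'. U' \<subseteq> U \<and> (\<forall>x. f x = (SUP u\<in>U'. Elt (u x))))"


section \<open>Convexity\<close>

text \<open>The right action of the scalars is passed as a parameter, so that the same definition
  covers \<open>\<K>\<^sup>n\<close> and \<open>\<K>\<^sup>n \<times> \<K>\<close>.\<close>

definition convex_wrt :: "('m::plus \<Rightarrow> 'k::idempotent_semiring \<Rightarrow> 'm) \<Rightarrow> 'm set \<Rightarrow> bool" where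
  "convex_wrt act C \<longleftrightarrow>
     (\<forall>x\<in>C. \<forall>y\<in>C. \<forall>\<alpha> \<beta>. \<alpha> + \<beta> = 1 \<longrightarrow> act x \<alpha> + act y \<beta> \<in> C)"

definition rscale :: "('n \<Rightarrow> 'k::times) \<Rightarrow> 'k \<Rightarrow> ('n \<Rightarrow> 'k)" where
  "rscale x \<alpha> = (\<lambda>i. x i * \<alpha>)"

definition rscale_pair :: "('n \<Rightarrow> 'k::times) \<times> 'k \<Rightarrow> 'k \<Rightarrow> ('n \<Rightarrow> 'k) \<times> 'k" where
  "rscale_pair p \<alpha> = (rscale (fst p) \<alpha>, snd p * \<alpha>)"

definition epigraph :: "(('n \<Rightarrow> 'k) \<Rightarrow> 'k::order completed) \<Rightarrow> (('n \<Rightarrow> 'k) \<times> 'k) set" where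
  "epigraph f = {(x, \<mu>). f x \<le> Elt \<mu>}"

definition convex_fun :: "(('n \<Rightarrow> 'k) \<Rightarrow> 'k::idempotent_semiring completed) \<Rightarrow> bool" where
  "convex_fun f \<longleftrightarrow> convex_wrt rscale_pair (epigraph f)"


section \<open>Order topology and lower semi-continuity\<close>

instance "fun" :: (type, conditionally_complete_lattice) conditionally_complete_lattice
proof
  fix x z :: "'a \<Rightarrow> 'b" and X :: "('a \<Rightarrow> 'b) set"
  show "Inf X \<le> x" if "x \<in> X" "bdd_below X"
    using that by (auto simp: le_fun_def Inf_apply bdd_below_def intro!: cINF_lower) blast
  show "z \<le> Inf X" if "X \<noteq> {}" "\<And>x. x \<in> X \<Longrightarrow> z \<le> x"
    using that by (auto simp: le_fun_def Inf_apply intro!: cINF_greatest)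
  show "x \<le> Sup X" if "x \<in> X" "bdd_above X"
    using that by (auto simp: le_fun_def Sup_apply bdd_above_def intro!: cSUP_upper) blast
  show "Sup X \<le> z" if "X \<noteq> {}" "\<And>x. x \<in> X \<Longrightarrow> x \<le> z"
    using that by (auto simp: le_fun_def Sup_apply intro!: cSUP_least)
qed

definition directed_preorder :: "'i set \<Rightarrow> ('i \<Rightarrow> 'i \<Rightarrow> bool) \<Rightarrow> bool" where
  "directed_preorder L le \<longleftrightarrow> L \<noteq> {} \<and> reflp_on L le \<and> transp_on L le \<and>
     (\<forall>l\<in>L. \<forall>m\<in>L. \<exists>k\<in>L. le l k \<and> le m k)"

definition order_converges ::
  "'i set \<Rightarrow> ('i \<Rightarrow> 'i \<Rightarrow> bool) \<Rightarrow> ('i \<Rightarrow> 's::conditionally_complete_lattice) \<Rightarrow> 's \<Rightarrow> bool" where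
  "order_converges L le x a \<longleftrightarrow>
     directed_preorder L le \<and> bdd_above (x ` L) \<and> bdd_below (x ` L) \<and>
     a = (INF l\<in>L. SUP m\<in>{m\<in>L. le l m}. x m) \<and>
     a = (SUP l\<in>L. INF m\<in>{m\<in>L. le l m}. x m)"

text \<open>A definition cannot quantify over all index types. Nets indexed by subsets of
  \<^typ>\<open>'s set \<times> 's\<close> suffice, because any net can be reindexed by the pairs of a tail and a member of
  it; this is the content of \<open>order_closed_net\<close> below.\<close>

definition order_closed :: "'s::conditionally_complete_lattice set \<Rightarrow> bool" where
  "order_closed X \<longleftrightarrow>
     (\<forall>(L :: ('s set \<times> 's) set) le x a.
        (\<forall>l\<in>L. x l \<in> X) \<and> order_converges L le x a \<longrightarrow> a \<in> X)"

lemma order_closed_net: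
  fixes L :: "'i set" and x :: "'i \<Rightarrow> 's::conditionally_complete_lattice"
  assumes closed: "order_closed X" and inX: "\<forall>l\<in>L. x l \<in> X" and conv: "order_converges L le x a"
  shows "a \<in> X"
proof -
  define T where "T l = x ` {m \<in> L. le l m}" for l
  define N where "N = {(T l, x m) | l m. l \<in> L \<and> m \<in> L \<and> le l m}"
  define le' :: "'s set \<times> 's \<Rightarrow> 's set \<times> 's \<Rightarrow> bool" where "le' p q \<longleftrightarrow> fst q \<subseteq> fst p" for p q
  have dir: "L \<noteq> {}" "\<And>l. l \<in> L \<Longrightarrow> le l l"
    "\<And>l m k. l \<in> L \<Longrightarrow> m \<in> L \<Longrightarrow> k \<in> L \<Longrightarrow> le l m \<Longrightarrow> le m k \<Longrightarrow> le l k"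
    "\<And>l m. l \<in> L \<Longrightarrow> m \<in> L \<Longrightarrow> \<exists>k\<in>L. le l k \<and> le m k"
    using conv unfolding order_converges_def directed_preorder_def
    by (auto dest: reflp_onD transp_onD)
  have mono: "T k \<subseteq> T l" if "l \<in> L" "k \<in> L" "le l k" for l k
    using that dir(3) unfolding T_def by blast
  have snd_N: "snd ` N = x ` L"
  proof
    show "snd ` N \<subseteq> x ` L" unfolding N_def by auto
    show "x ` L \<subseteq> snd ` N"
    proof
      fix y assume "y \<in> x ` L"
      then obtain l where l: "l \<in> L" "y = x l" by auto
      then have "(T l, x l) \<in> N" unfolding N_def using dir(2) by blast
      then show "y \<in> snd ` N" using l by force
    qed
  qed
  have fst_N: "fst ` N = T ` L"
  proof
    show "fst ` N \<subseteq> T ` L" unfolding N_def by auto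
    show "T ` L \<subseteq> fst ` N"
    proof
      fix S assume "S \<in> T ` L"
      then obtain l where l: "l \<in> L" "S = T l" by auto
      then have "(T l, x l) \<in> N" unfolding N_def using dir(2) by blast
      then show "S \<in> fst ` N" using l by force
    qed
  qed
  have tail: "snd ` {q \<in> N. le' p q} = fst p" if p: "p \<in> N" for p
  proof
    show "snd ` {q \<in> N. le' p q} \<subseteq> fst p"
      unfolding N_def le'_def T_def by auto
    show "fst p \<subseteq> snd ` {q \<in> N. le' p q}"
    proof
      fix y assume y: "y \<in> fst p"
      obtain l where l: "l \<in> L" "fst p = T l" using p unfolding N_def by auto
      then obtain m where "m \<in> L" "le l m" "y = x m" using y unfolding T_def by auto
      then have "(fst p, y) \<in> N" using l unfolding N_def by auto
      then show "y \<in> snd ` {q \<in> N. le' p q}" unfolding le'_def by force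
    qed
  qed
  have dir': "directed_preorder N le'"
    unfolding directed_preorder_def
  proof (intro conjI ballI)
    show "N \<noteq> {}" using fst_N dir(1) by auto
    show "reflp_on N le'" "transp_on N le'"
      unfolding le'_def by (auto intro: reflp_onI transp_onI)
    fix p q assume "p \<in> N" "q \<in> N"
    then obtain l m where lm: "l \<in> L" "fst p = T l" "m \<in> L" "fst q = T m"
      unfolding N_def by auto
    then obtain k where k: "k \<in> L" "le l k" "le m k" using dir(4) by blast
    have "(T k, x k) \<in> N" unfolding N_def using k dir(2) by blast
    moreover have "le' p (T k, x k)" "le' q (T k, x k)"
      unfolding le'_def using mono lm k by auto
    ultimately show "\<exists>k\<in>N. le' p k \<and> le' q k" by blast
  qed
  have "(\<lambda>p. Sup (snd ` {q \<in> N. le' p q})) ` N = Sup ` fst ` N"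
    unfolding image_image using tail by (intro image_cong) auto
  moreover have "(\<lambda>p. Inf (snd ` {q \<in> N. le' p q})) ` N = Inf ` fst ` N"
    unfolding image_image using tail by (intro image_cong) auto
  moreover have "a = Inf (Sup ` T ` L)" "a = Sup (Inf ` T ` L)"
    "bdd_above (x ` L)" "bdd_below (x ` L)"
    using conv unfolding order_converges_def T_def image_image by auto
  ultimately have "order_converges N le' snd a"
    unfolding order_converges_def using dir' by (simp only: snd_N fst_N simp_thms)
  moreover have "\<forall>p\<in>N. snd p \<in> X" using inX unfolding N_def by auto
  ultimately show "a \<in> X" using closed unfolding order_closed_def by blast
qed

definition lower_semicontinuous ::
  "(('n \<Rightarrow> 'k) \<Rightarrow> 'k::conditionally_complete_lattice completed) \<Rightarrow> bool" where
  "lower_semicontinuous f \<longleftrightarrow> (\<forall>t. order_closed {x. f x \<le> t})"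

end

theory Submission
  imports Defs
begin

text \<open>The existence of all residuals \<open>\<nu> \<ominus> \<kappa>\<close> forces the order to be total. Affine functions then
  preserve strict inequalities along order convergent nets, which gives the ``if'' part.

  Conversely, suppose that every minorant of \<open>f\<close> among the differences of affine functions is at most
  \<open>\<mu> \<noteq> 0\<close> at \<open>x\<^sub>0\<close>. Every difference that exceeds \<open>\<mu>\<close> at \<open>x\<^sub>0\<close> thus exceeds \<open>f\<close> somewhere. Applied
  to the differences with one chosen coordinate in the minuend, this yields scaled points of the
  epigraph that lie below a perturbation \<open>a\<close> of \<open>x\<^sub>0\<close> with invertible coordinates and nearly reach
  \<open>x\<^sub>0\<close> in that coordinate. The perturbation is what keeps all coefficients in \<open>\<K>\<close>. By convexity, the sum
  of such points over all coordinates, normalised, is a point close to \<open>x\<^sub>0\<close> where \<open>f\<close> is nearly at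
  most \<open>\<mu>\<close>, and lower semi-continuity yields \<open>f x\<^sub>0 \<le> \<mu>\<close>.\<close>

section \<open>Order and inverses\<close>

lemma plus_upper [simp]:
  fixes a b :: "'k::idempotent_semiring"
  shows "a \<le> a + b" "b \<le> a + b"
  unfolding natural_le by (metis add.assoc add.commute add_idem)+

lemma plus_le_iff:
  fixes a b c :: "'k::idempotent_semiring"
  shows "a + b \<le> c \<longleftrightarrow> a \<le> c \<and> b \<le> c"
proof
  show "a \<le> c \<and> b \<le> c" if "a + b \<le> c"
    using that by (meson order_trans plus_upper)
  show "a + b \<le> c" if "a \<le> c \<and> b \<le> c"
    using that unfolding natural_le by (metis add.assoc)
qed

lemma plus_upperI:
  fixes a b c :: "'k::idempotent_semiring"
  shows "a \<le> b \<Longrightarrow> a \<le> b + c" "a \<le> c \<Longrightarrow> a \<le> b + c"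
  using order_trans[OF _ plus_upper(1)] order_trans[OF _ plus_upper(2)] by blast+

lemma plus_mono:
  fixes a b c d :: "'k::idempotent_semiring"
  assumes "a \<le> b" "c \<le> d" shows "a + c \<le> b + d"
  using assms by (simp add: plus_le_iff plus_upperI)

lemma sum_le_iff:
  fixes g :: "'i \<Rightarrow> 'k::idempotent_semiring"
  assumes "finite I"
  shows "sum g I \<le> c \<longleftrightarrow> (\<forall>i\<in>I. g i \<le> c)"
  using assms by (induction I) (auto simp: plus_le_iff zero_least)

lemma times_left_mono:
  fixes a b c :: "'k::idempotent_semiring"
  assumes "a \<le> b" shows "c * a \<le> c * b"
  using assms unfolding natural_le by (metis distrib_left)

lemma times_right_mono:
  fixes a b c :: "'k::idempotent_semiring"
  assumes "a \<le> b" shows "a * c \<le> b * c"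
  using assms unfolding natural_le by (metis distrib_right)

lemma times_mono:
  fixes a b c d :: "'k::idempotent_semiring"
  assumes "a \<le> b" "c \<le> d" shows "a * c \<le> b * d"
  using times_right_mono[OF assms(1)] times_left_mono[OF assms(2)] by (rule order_trans)

section \<open>Inverses of nonzero elements\<close>

definition semifield_inv :: "'k::idempotent_semifield \<Rightarrow> 'k" where
  "semifield_inv a = (SOME b. a * b = 1 \<and> b * a = 1)"

lemma
  fixes a :: "'k::idempotent_semifield"
  assumes "a \<noteq> 0"
  shows times_semifield_inv [simp]: "a * semifield_inv a = 1"
    and semifield_inv_times [simp]: "semifield_inv a * a = 1"
  using someI_ex[OF ex_inverse[OF assms]] unfolding semifield_inv_def by blast+

lemma semifield_inv_nonzero:
  fixes a :: "'k::idempotent_semifield"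
  assumes "a \<noteq> 0" shows "semifield_inv a \<noteq> 0"
  using times_semifield_inv[OF assms] by (metis mult_zero_right zero_neq_one)

lemma semifield_inv_cancel [simp]:
  fixes a :: "'k::idempotent_semifield"
  assumes "a \<noteq> 0"
  shows "a * (semifield_inv a * b) = b" "semifield_inv a * (a * b) = b"
    "b * semifield_inv a * a = b" "b * a * semifield_inv a = b"
  using assms by (simp_all flip: mult.assoc) (simp_all add: mult.assoc)

lemma times_left_le_iff:
  fixes a b c :: "'k::idempotent_semifield"
  assumes "c \<noteq> 0" shows "c * a \<le> c * b \<longleftrightarrow> a \<le> b"
  using times_left_mono[of a b c] times_left_mono[of "c * a" "c * b" "semifield_inv c"] assms
  by auto

lemma times_right_le_iff:
  fixes a b c :: "'k::idempotent_semifield"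
  assumes "c \<noteq> 0" shows "a * c \<le> b * c \<longleftrightarrow> a \<le> b"
  using times_right_mono[of a b c] times_right_mono[of "a * c" "b * c" "semifield_inv c"] assms
  by auto

lemma le_times_semifield_inv_iff:
  fixes a b c :: "'k::idempotent_semifield"
  assumes "c \<noteq> 0" shows "a \<le> b * semifield_inv c \<longleftrightarrow> a * c \<le> b"
  using times_right_le_iff[OF assms, of a "b * semifield_inv c"] assms by simp

lemma semifield_inv_times_le_iff:
  fixes a b c :: "'k::idempotent_semifield"
  assumes "c \<noteq> 0" shows "semifield_inv c * a \<le> b \<longleftrightarrow> a \<le> c * b"
  using times_left_le_iff[OF assms, of "semifield_inv c * a" b] assms by simp

lemma le_semifield_inv_times_iff:
  fixes a b c :: "'k::idempotent_semifield"
  assumes "c \<noteq> 0" shows "b \<le> semifield_inv c * a \<longleftrightarrow> c * b \<le> a"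
  using times_left_le_iff[OF assms, of b "semifield_inv c * a"] assms by simp

lemma semifield_inv_antimono:
  fixes a b :: "'k::idempotent_semifield"
  assumes "a \<noteq> 0" "a \<le> b" shows "semifield_inv b \<le> semifield_inv a"
proof -
  have "b \<noteq> 0" using assms by (metis zero_least order.antisym)
  then have "semifield_inv b * a \<le> 1" using assms by (simp add: semifield_inv_times_le_iff)
  then show ?thesis using le_times_semifield_inv_iff[OF assms(1), of "semifield_inv b" 1] by simp
qed

text \<open>The existence hypothesis makes \<open>LEAST\<close> a true minimum, and monotonicity of
  \<open>+\<close> makes the solutions an up-set. This residuation law trades every
  \<open>\<ominus>\<close> below for an inequality.\<close>

lemma ominus_le_iff:
  fixes \<nu> \<kappa> \<mu> :: "'k::idempotent_semiring"
  assumes "\<forall>\<nu> \<kappa>::'k. \<exists>\<mu>. \<kappa> + \<mu> \<ge> \<nu> \<and> (\<forall>\<mu>'. \<kappa> + \<mu>' \<ge> \<nu> \<longrightarrow> \<mu> \<le> \<mu>')"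
  shows "\<nu> \<ominus> \<kappa> \<le> \<mu> \<longleftrightarrow> \<nu> \<le> \<kappa> + \<mu>"
proof -
  obtain m where m: "\<nu> \<le> \<kappa> + m" "\<And>\<mu>'. \<nu> \<le> \<kappa> + \<mu>' \<Longrightarrow> m \<le> \<mu>'" using assms by blast
  have "\<nu> \<ominus> \<kappa> = m" unfolding ominus_def by (rule Least_equality) (use m in auto)
  moreover have "\<nu> \<le> \<kappa> + \<mu>" if "m \<le> \<mu>"
  proof -
    have "\<kappa> + m \<le> \<kappa> + \<mu>" using that by (simp add: plus_mono)
    then show ?thesis using m(1) by (rule order_trans[rotated])
  qed
  ultimately show ?thesis using m(2) by blast
qed

text \<open>If \<open>\<mu>\<close> is the least solution of \<open>g \<le> 1 \<oplus> \<mu>\<close> and \<open>b = 1 \<oplus> g\<^sup>-\<^sup>1\<close>, then \<open>\<mu> b\<^sup>-\<^sup>1\<close> is a solution as well,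
  so \<open>b \<le> 1\<close> unless \<open>\<mu> = 0\<close>.\<close>

lemma linear_if_ominus_exists:
  fixes x y :: "'k::idempotent_semifield"
  assumes ominus_exists: "\<forall>\<nu> \<kappa>::'k. \<exists>\<mu>. \<kappa> + \<mu> \<ge> \<nu> \<and> (\<forall>\<mu>'. \<kappa> + \<mu>' \<ge> \<nu> \<longrightarrow> \<mu> \<le> \<mu>')"
  shows "x \<le> y \<or> y \<le> x"
proof -
  have one: "g \<le> 1 \<or> 1 \<le> g" if g: "g \<noteq> 0" for g :: 'k
  proof -
    obtain m where m: "g \<le> 1 + m" "\<And>m'. g \<le> 1 + m' \<Longrightarrow> m \<le> m'" using ominus_exists by blast
    show ?thesis
    proof (cases "m = 0")
      case False
      define b where "b = 1 + semifield_inv g"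
      have b0: "b \<noteq> 0" unfolding b_def using add_eq_zero_iff zero_neq_one by metis
      have "g * b \<le> (1 + m * semifield_inv b) * b"
      proof -
        have "g * b = g + 1" unfolding b_def using g by (simp add: distrib_left)
        also have "\<dots> \<le> 1 + m" using m(1) by (simp add: plus_le_iff)
        also have "\<dots> \<le> b + m" unfolding b_def by (metis add.assoc add.commute plus_upper(1))
        also have "\<dots> = (1 + m * semifield_inv b) * b" using b0 by (simp add: distrib_right)
        finally show ?thesis .
      qed
      then have "g \<le> 1 + m * semifield_inv b" using times_right_le_iff[OF b0] by blast
      then have "m \<le> m * semifield_inv b" by (rule m(2))
      then have "m * b \<le> m * 1" using b0 by (simp add: le_times_semifield_inv_iff)
      then have "b \<le> 1" using times_left_le_iff False by blast
      then have "semifield_inv g * 1 \<le> 1" unfolding b_def by (simp add: plus_le_iff)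
      then have "1 \<le> g" using g semifield_inv_times_le_iff by (metis mult_1_right)
      then show ?thesis ..
    qed (use m(1) in simp)
  qed
  show ?thesis
  proof (cases "x = 0 \<or> y = 0")
    case False
    then have "x * semifield_inv y \<noteq> 0" by (simp add: mult_eq_zero_iff semifield_inv_nonzero)
    from one[OF this] have "x * semifield_inv y * y \<le> 1 * y \<or> 1 * y \<le> x * semifield_inv y * y"
      using times_right_mono by blast
    then show ?thesis using False by simp
  qed (auto simp: zero_least)
qed


section \<open>Order convergence\<close>

lemma order_closed_INT:
  assumes "\<And>i. i \<in> I \<Longrightarrow> order_closed (X i)"
  shows "order_closed (\<Inter>i\<in>I. X i)"
  unfolding order_closed_def
proof (intro allI impI INT_I, elim conjE)
  fix L le x a i
  assume "\<forall>l\<in>L. x l \<in> (\<Inter>i\<in>I. X i)" and conv: "order_converges L le x a" and i: "i \<in> I"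
  then have "\<forall>l\<in>L. x l \<in> X i" by blast
  then show "a \<in> X i" by (rule order_closed_net[OF assms[OF i] _ conv])
qed

text \<open>Builds an order convergent net from bounds alone. It is indexed by the intervals with
  ends in \<open>Lo\<close> and \<open>Hi\<close>; a point of \<open>X\<close> chosen in each has
  its tail infima and suprema squeezed onto \<open>a\<close>.\<close>

lemma order_closed_squeeze:
  fixes X :: "'s::conditionally_complete_lattice set"
  assumes closed: "order_closed X"
    and Lo: "Lo \<noteq> {}" "bdd_below Lo" "\<And>l m. l \<in> Lo \<Longrightarrow> m \<in> Lo \<Longrightarrow> \<exists>k\<in>Lo. l \<le> k \<and> m \<le> k"
      "\<And>l. l \<in> Lo \<Longrightarrow> l \<le> a" "\<And>y. (\<And>l. l \<in> Lo \<Longrightarrow> l \<le> y) \<Longrightarrow> a \<le> y"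
    and Hi: "Hi \<noteq> {}" "bdd_above Hi" "\<And>l m. l \<in> Hi \<Longrightarrow> m \<in> Hi \<Longrightarrow> \<exists>k\<in>Hi. k \<le> l \<and> k \<le> m"
      "\<And>h. h \<in> Hi \<Longrightarrow> a \<le> h" "\<And>y. (\<And>h. h \<in> Hi \<Longrightarrow> y \<le> h) \<Longrightarrow> y \<le> a"
    and squeeze: "\<And>l h. l \<in> Lo \<Longrightarrow> h \<in> Hi \<Longrightarrow> \<exists>q\<in>X. l \<le> q \<and> q \<le> h"
  shows "a \<in> X"
proof -
  define L where "L = Lo \<times> Hi"
  \<comment> \<open>Smaller intervals come later.\<close>
  define le where "le p p' \<longleftrightarrow> fst p \<le> fst p' \<and> snd p' \<le> snd p" for p p' :: "'s \<times> 's"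
  have "\<exists>q. \<forall>p\<in>L. q p \<in> X \<and> fst p \<le> q p \<and> q p \<le> snd p"
    using squeeze by (intro bchoice) (auto simp: L_def)
  then obtain q where q: "\<And>p. p \<in> L \<Longrightarrow> q p \<in> X" "\<And>p. p \<in> L \<Longrightarrow> fst p \<le> q p"
    "\<And>p. p \<in> L \<Longrightarrow> q p \<le> snd p" by blast
  define T where "T p = {m \<in> L. le p m}" for p
  have refl: "p \<in> T p" if "p \<in> L" for p using that by (simp add: T_def le_def)
  have dir: "\<exists>k\<in>L. le p k \<and> le p' k" if "p \<in> L" "p' \<in> L" for p p'
  proof -
    have "fst p \<in> Lo" "fst p' \<in> Lo" "snd p \<in> Hi" "snd p' \<in> Hi" using that by (auto simp: L_def)
    then obtain l h where "l \<in> Lo" "fst p \<le> l" "fst p' \<le> l" "h \<in> Hi" "h \<le> snd p" "h \<le> snd p'"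
      using Lo(3) Hi(3) by meson
    then show ?thesis by (intro bexI[of _ "(l, h)"]) (auto simp: L_def le_def)
  qed
  have lower: "fst p \<le> q m" and upper: "q m \<le> snd p" if "m \<in> T p" for p m
    using that q(2,3)[of m] by (auto simp: T_def le_def intro: order_trans)
  have bA: "bdd_above (q ` L)"
  proof -
    obtain M where "\<And>h. h \<in> Hi \<Longrightarrow> h \<le> M" using Hi(2) by (auto simp: bdd_above_def)
    then show ?thesis
      using q(3) by (intro bdd_aboveI2[of _ _ M]) (metis L_def mem_Times_iff order_trans)
  qed
  have bB: "bdd_below (q ` L)"
  proof -
    obtain M where "\<And>l. l \<in> Lo \<Longrightarrow> M \<le> l" using Lo(2) by (auto simp: bdd_below_def)
    then show ?thesis
      using q(2) by (intro bdd_belowI2[of _ M]) (metis L_def mem_Times_iff order_trans)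
  qed
  have bT: "bdd_above (q ` T p)" "bdd_below (q ` T p)" for p
    using bA bB by (auto simp: T_def intro: bdd_above_mono bdd_below_mono)
  have sup_le: "(SUP m\<in>T p. q m) \<le> snd p" if "p \<in> L" for p
    using refl[OF that] upper by (intro cSUP_least) auto
  have le_inf: "fst p \<le> (INF m\<in>T p. q m)" if "p \<in> L" for p
    using refl[OF that] lower by (intro cINF_greatest) auto
  \<comment> \<open>Every tail meets the tail of \<open>(l, h)\<close>, so its supremum lies above
    each \<open>l\<close>, hence above their least upper bound \<open>a\<close>. Tail infima are
    dual.\<close>
  have le_sup: "l \<le> (SUP m\<in>T p. q m)" if "p \<in> L" "l \<in> Lo" for l p
  proof -
    obtain h where "h \<in> Hi" using Hi(1) by blast
    then have "(l, h) \<in> L" using that by (simp add: L_def)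
    from dir[OF that(1) this] obtain k where "k \<in> L" "le p k" "le (l, h) k" by blast
    then have "k \<in> T p" "l \<le> q k" using lower[of k "(l, h)"] by (auto simp: T_def)
    then show ?thesis using bT by (meson cSUP_upper order_trans)
  qed
  have inf_le: "(INF m\<in>T p. q m) \<le> h" if "p \<in> L" "h \<in> Hi" for h p
  proof -
    obtain l where "l \<in> Lo" using Lo(1) by blast
    then have "(l, h) \<in> L" using that by (simp add: L_def)
    from dir[OF that(1) this] obtain k where "k \<in> L" "le p k" "le (l, h) k" by blast
    then have "k \<in> T p" "q k \<le> h" using upper[of k "(l, h)"] by (auto simp: T_def)
    then show ?thesis using bT by (meson cINF_lower order_trans)
  qed
  have L0: "L \<noteq> {}" using Lo(1) Hi(1) by (auto simp: L_def)
  have ge: "a \<le> (SUP m\<in>T p. q m)" if "p \<in> L" for p using le_sup[OF that] by (rule Lo(5))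
  have leq: "(INF m\<in>T p. q m) \<le> a" if "p \<in> L" for p using inf_le[OF that] by (rule Hi(5))
  have eq1: "a = (INF p\<in>L. SUP m\<in>T p. q m)"
  proof (rule order.antisym)
    show "a \<le> (INF p\<in>L. SUP m\<in>T p. q m)" using L0 ge by (intro cINF_greatest)
    have bdd: "bdd_below ((\<lambda>p. SUP m\<in>T p. q m) ` L)" using ge by (rule bdd_belowI2)
    show "(INF p\<in>L. SUP m\<in>T p. q m) \<le> a"
    proof (rule Hi(5))
      fix h assume "h \<in> Hi"
      then obtain l where "(l, h) \<in> L" using Lo(1) unfolding L_def by blast
      then show "(INF p\<in>L. SUP m\<in>T p. q m) \<le> h"
        using order_trans[OF cINF_lower[OF bdd] sup_le] by fastforce
    qed
  qed
  have eq2: "a = (SUP p\<in>L. INF m\<in>T p. q m)"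
  proof (rule order.antisym)
    show "(SUP p\<in>L. INF m\<in>T p. q m) \<le> a" using L0 leq by (intro cSUP_least)
    have bdd: "bdd_above ((\<lambda>p. INF m\<in>T p. q m) ` L)" using leq by (rule bdd_aboveI2)
    show "a \<le> (SUP p\<in>L. INF m\<in>T p. q m)"
    proof (rule Lo(5))
      fix l assume "l \<in> Lo"
      then obtain h where "(l, h) \<in> L" using Hi(1) unfolding L_def by blast
      then show "l \<le> (SUP p\<in>L. INF m\<in>T p. q m)"
        using order_trans[OF le_inf cSUP_upper[OF _ bdd]] by fastforce
    qed
  qed
  have "directed_preorder L le"
    unfolding directed_preorder_def
    using L0 dir by (auto simp: le_def intro!: reflp_onI transp_onI)
  then have "order_converges L le q a"
    unfolding order_converges_def using bA bB eq1 eq2 by (auto simp: T_def)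
  then show ?thesis using order_closed_net[OF closed, of L q le a] q(1) by blast
qed

section \<open>Limits of affine inequalities under a total order\<close>

context
  assumes linear: "\<And>a b :: 'k::cond_complete_idempotent_semifield. a \<le> b \<or> b \<le> a"
begin

lemma not_le_iff_less: "\<not> (a::'k) \<le> b \<longleftrightarrow> b < a"
  using linear[of a b] by auto

text \<open>Under a total order a sum is the larger of its terms; strict bounds do not pass to
  general joins.\<close>

lemma plus_less_iff: "(a::'k) + b < c \<longleftrightarrow> a < c \<and> b < c"
  using linear[of a b] by (auto simp: natural_le add.commute)
    (metis add.commute natural_le order_le_less_trans)+

text \<open>As the order is total, an infimum of tail suprema below \<open>c\<close> puts one tail
  supremum below \<open>c\<close>; its coordinate \<open>i\<close> serves as
  \<open>c'\<close>.\<close>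

lemma order_converges_upper:
  fixes X :: "'i \<Rightarrow> 'n \<Rightarrow> 'k"
  assumes conv: "order_converges L le X a" and less: "a i < c"
  shows "\<exists>c'<c. \<exists>l\<in>L. \<forall>m\<in>L. le l m \<longrightarrow> X m i \<le> c'"
proof -
  define Z where "Z l = (SUP m\<in>{m\<in>L. le l m}. X m)" for l
  have a: "a = (INF l\<in>L. Z l)" and bdd: "bdd_above (X ` L)" and L0: "L \<noteq> {}"
    using conv by (auto simp: order_converges_def Z_def directed_preorder_def)
  have ai: "a i = (INF l\<in>L. Z l i)" unfolding a by (simp add: Inf_apply image_image)
  have "\<exists>l\<in>L. Z l i < c"
  proof (rule ccontr)
    assume "\<not> ?thesis"
    then have "c \<le> Z l i" if "l \<in> L" for l using that not_le_iff_less by blast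
    then have "c \<le> a i" unfolding ai using L0 by (intro cINF_greatest) auto
    then show False using less by simp
  qed
  then obtain l where l: "l \<in> L" "Z l i < c" by blast
  have "X m \<le> Z l" if "m \<in> L" "le l m" for m
    unfolding Z_def using that bdd by (intro cSUP_upper) (auto intro: bdd_above_mono)
  then show ?thesis using l by (auto simp: le_fun_def)
qed

lemma order_converges_lower:
  fixes X :: "'i \<Rightarrow> 'n \<Rightarrow> 'k"
  assumes conv: "order_converges L le X a" and less: "c < a i"
  shows "\<exists>l\<in>L. \<forall>m\<in>L. le l m \<longrightarrow> c < X m i"
proof -
  define Y where "Y l = (INF m\<in>{m\<in>L. le l m}. X m)" for l
  have a: "a = (SUP l\<in>L. Y l)" and bdd: "bdd_below (X ` L)" and L0: "L \<noteq> {}"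
    using conv by (auto simp: order_converges_def Y_def directed_preorder_def)
  have ai: "a i = (SUP l\<in>L. Y l i)" unfolding a by (simp add: Sup_apply image_image)
  have "\<exists>l\<in>L. c < Y l i"
  proof (rule ccontr)
    assume "\<not> ?thesis"
    then have "Y l i \<le> c" if "l \<in> L" for l using that not_le_iff_less by blast
    then have "a i \<le> c" unfolding ai using L0 by (intro cSUP_least) auto
    then show False using less by simp
  qed
  then obtain l where l: "l \<in> L" "c < Y l i" by blast
  have "Y l \<le> X m" if "m \<in> L" "le l m" for m
    unfolding Y_def using that bdd by (intro cINF_lower) (auto intro: bdd_below_mono)
  then show ?thesis using l by (auto simp: le_fun_def intro: order_less_le_trans)
qed

text \<open>Induction over the coordinates: pass to a common tail and take the larger bound. By
  \<open>0 < c\<close>, the bound 0 is available for the empty sum and for vanishing coefficients,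
  which cannot be divided out.\<close>

lemma order_converges_sum_upper:
  fixes X :: "'i \<Rightarrow> 'n \<Rightarrow> 'k" and w :: "'n \<Rightarrow> 'k"
  assumes conv: "order_converges L le X a"
    and "finite I" "0 < c" "(\<Sum>i\<in>I. w i * a i) < c"
  shows "\<exists>c'<c. \<exists>l\<in>L. \<forall>m\<in>L. le l m \<longrightarrow> (\<Sum>i\<in>I. w i * X m i) \<le> c'"
  using assms(2-)
proof (induction I)
  case empty
  then show ?case using conv by (auto simp: order_converges_def directed_preorder_def)
next
  case (insert i I)
  then have less: "w i * a i < c" "(\<Sum>i\<in>I. w i * a i) < c" by (simp_all add: plus_less_iff)
  obtain c1 l1 where 1: "c1 < c" "l1 \<in> L" "\<And>m. m \<in> L \<Longrightarrow> le l1 m \<Longrightarrow> (\<Sum>i\<in>I. w i * X m i) \<le> c1"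
    using insert.IH insert.prems less by blast
  obtain c2 l2 where 2: "c2 < c" "l2 \<in> L" "\<And>m. m \<in> L \<Longrightarrow> le l2 m \<Longrightarrow> w i * X m i \<le> c2"
  proof (cases "w i = 0")
    case True
    then show ?thesis using that[of 0 l1] 1 insert.prems by simp
  next
    case False
    have "a i < semifield_inv (w i) * c"
      using less(1) False le_semifield_inv_times_iff semifield_inv_times_le_iff
      by (metis not_le_iff_less)
    from order_converges_upper[OF conv this] obtain c' l
      where c': "c' < semifield_inv (w i) * c" "l \<in> L" "\<And>m. m \<in> L \<Longrightarrow> le l m \<Longrightarrow> X m i \<le> c'" by blast
    have "w i * c' < c" using c'(1) False semifield_inv_times_le_iff by (metis not_le_iff_less)
    then show ?thesis using that c' times_left_mono by blast
  qed
  obtain l where l: "l \<in> L" "le l1 l" "le l2 l"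
    using conv 1(2) 2(2) unfolding order_converges_def directed_preorder_def by blast
  have tr: "le l1 m" "le l2 m" if "m \<in> L" "le l m" for m
    using conv 1(2) 2(2) l that unfolding order_converges_def directed_preorder_def
    by (meson transp_onD)+
  have "(\<Sum>i\<in>insert i I. w i * X m i) \<le> c2 + c1" if "m \<in> L" "le l m" for m
    using that 1(3) 2(3) tr insert.hyps by (simp add: plus_mono)
  moreover have "c2 + c1 < c" using 1 2 by (simp add: plus_less_iff)
  ultimately show ?case using l(1) by blast
qed

text \<open>If the inequality failed at the limit, the right side would stay, on a tail, below some
  \<open>c' + d''\<close> that is still smaller than the left side at \<open>a\<close>. That left
  side is a maximum, so one of its terms exceeds the bound. It is not \<open>d'\<close>, and a
  coordinate term exceeds the bound along the net too.\<close>

lemma order_closed_affine_le: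
  fixes w' w'' :: "'n::finite \<Rightarrow> 'k"
  shows "order_closed {x. inner_prod w' x + d' \<le> inner_prod w'' x + d''}"
  unfolding order_closed_def
proof (intro allI impI, elim conjE)
  fix L :: "(('n \<Rightarrow> 'k) set \<times> ('n \<Rightarrow> 'k)) set" and le X a
  assume inX: "\<forall>l\<in>L. X l \<in> {x. inner_prod w' x + d' \<le> inner_prod w'' x + d''}"
    and conv: "order_converges L le X a"
  have inX: "inner_prod w' (X m) + d' \<le> inner_prod w'' (X m) + d''" if "m \<in> L" for m
    using inX that by blast
  show "a \<in> {x. inner_prod w' x + d' \<le> inner_prod w'' x + d''}"
  proof (rule ccontr)
    assume "\<not> ?thesis"
    then have "\<not> inner_prod w' a + d' \<le> inner_prod w'' a + d''" by simp
    then have less: "inner_prod w'' a + d'' < inner_prod w' a + d'" (is "_ < ?c")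
      by (simp add: not_le_iff_less)
    then have "inner_prod w'' a < ?c" "d'' < ?c" "0 < ?c"
      using zero_least order_le_less_trans by (auto simp: plus_less_iff)
    then obtain c' l where l: "c' < ?c" "l \<in> L"
      "\<And>m. m \<in> L \<Longrightarrow> le l m \<Longrightarrow> inner_prod w'' (X m) \<le> c'"
      using order_converges_sum_upper[OF conv, of UNIV ?c w''] unfolding inner_prod_def by auto
    have bound: "inner_prod w' (X m) + d' \<le> c' + d''" if "m \<in> L" "le l m" for m
      using inX[OF that(1)] plus_mono[OF l(3)[OF that] order_refl] by (rule order_trans)
    have c: "c' + d'' < ?c" using l \<open>d'' < ?c\<close> by (simp add: plus_less_iff)
    have "le l l" using conv l(2) unfolding order_converges_def directed_preorder_def
      by (auto dest: reflp_onD)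
    then have d': "d' \<le> c' + d''" using bound[OF l(2)] by (simp add: plus_le_iff)
    then have "\<not> inner_prod w' a \<le> c' + d''" using c by (metis plus_le_iff leD)
    then obtain i where i: "c' + d'' < w' i * a i"
      unfolding inner_prod_def by (auto simp: sum_le_iff not_le_iff_less)
    then have w: "w' i \<noteq> 0" using zero_least by (metis leD mult_zero_left)
    have "semifield_inv (w' i) * (c' + d'') < a i"
      using i w by (metis not_le_iff_less le_semifield_inv_times_iff)
    from order_converges_lower[OF conv this] obtain k
      where k: "k \<in> L" "\<And>m. m \<in> L \<Longrightarrow> le k m \<Longrightarrow> semifield_inv (w' i) * (c' + d'') < X m i" by blast
    obtain m where m: "m \<in> L" "le l m" "le k m"
      using conv l(2) k(1) unfolding order_converges_def directed_preorder_def by blast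
    have "c' + d'' < w' i * X m i"
      using k(2)[OF m(1,3)] w by (metis not_le_iff_less le_semifield_inv_times_iff)
    also have "\<dots> \<le> inner_prod w' (X m)"
      using sum_le_iff[of UNIV "\<lambda>i. w' i * X m i"] unfolding inner_prod_def by auto
    also have "\<dots> \<le> c' + d''" using bound m by (simp add: plus_le_iff)
    finally show False by simp
  qed
qed

end


section \<open>Suprema of differences of affine functions\<close>

lemma inner_prod_plus_rscale:
  fixes w x y :: "'n::finite \<Rightarrow> 'k::idempotent_semiring"
  shows "inner_prod w (rscale x \<alpha> + rscale y \<beta>) = inner_prod w x * \<alpha> + inner_prod w y * \<beta>"
  by (simp add: inner_prod_def rscale_def distrib_left sum.distrib sum_distrib_right mult.assoc)

text \<open>By residuation the epigraph of \<open>u\<close> is the solution set of one affine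
  inequality in \<open>(x, t)\<close>; convexity and closedness are read off from it.\<close>

lemma affine_difference_le_iff:
  fixes u :: "('n::finite \<Rightarrow> 'k::idempotent_semiring) \<Rightarrow> 'k"
  assumes ominus_exists: "\<forall>\<nu> \<kappa>::'k. \<exists>\<mu>. \<kappa> + \<mu> \<ge> \<nu> \<and> (\<forall>\<mu>'. \<kappa> + \<mu>' \<ge> \<nu> \<longrightarrow> \<mu> \<le> \<mu>')"
    and "u \<in> affine_differences"
  shows "\<exists>w' w'' d' d''. \<forall>x t. u x \<le> t \<longleftrightarrow> inner_prod w' x + d' \<le> inner_prod w'' x + (d'' + t)"
proof -
  obtain w' w'' d' d'' where "u = (\<lambda>x. (inner_prod w' x + d') \<ominus> (inner_prod w'' x + d''))"
    using assms(2) unfolding affine_differences_def by force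
  then have "u x \<le> t \<longleftrightarrow> inner_prod w' x + d' \<le> inner_prod w'' x + (d'' + t)" for x t
    by (simp add: ominus_le_iff[OF ominus_exists] add.assoc)
  then show ?thesis by blast
qed

text \<open>The epigraph of a supremum is the intersection of the epigraphs, and affine inequalities
  pass to convex combinations.\<close>

lemma U_convex_imp_convex_fun:
  fixes f :: "('n::finite \<Rightarrow> 'k::cond_complete_idempotent_semifield) \<Rightarrow> 'k completed"
  assumes ominus_exists: "\<forall>\<nu> \<kappa>::'k. \<exists>\<mu>. \<kappa> + \<mu> \<ge> \<nu> \<and> (\<forall>\<mu>'. \<kappa> + \<mu>' \<ge> \<nu> \<longrightarrow> \<mu> \<le> \<mu>')"
    and U: "U_convex affine_differences f"
  shows "convex_fun f"
proof -
  obtain U' where U': "U' \<subseteq> affine_differences" "\<And>x. f x = (SUP u\<in>U'. Elt (u x))"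
    using U unfolding U_convex_def by blast
  have f_le: "f x \<le> Elt t \<longleftrightarrow> (\<forall>u\<in>U'. u x \<le> t)" for x t
    by (simp add: U'(2) SUP_le_iff)
  have "u (rscale x \<alpha> + rscale y \<beta>) \<le> s * \<alpha> + t * \<beta>"
    if u: "u \<in> U'" and le: "u x \<le> s" "u y \<le> t" and sum: "\<alpha> + \<beta> = 1" for u x y s t \<alpha> \<beta>
  proof -
    have "u \<in> affine_differences" using u U'(1) by blast
    from affine_difference_le_iff[OF ominus_exists this] obtain w' w'' d' d'' where
      u_le: "\<forall>x t. u x \<le> t \<longleftrightarrow> inner_prod w' x + d' \<le> inner_prod w'' x + (d'' + t)"
      by (elim exE)
    have affine: "inner_prod w (rscale x \<alpha> + rscale y \<beta>) + d
        = (inner_prod w x + d) * \<alpha> + (inner_prod w y + d) * \<beta>" for w d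
    proof -
      \<comment> \<open>The normalisation of the coefficients splits the constant term, so affine
        forms commute with convex combinations.\<close>
      have "d = d * \<alpha> + d * \<beta>" using sum by (metis distrib_left mult_1_right)
      then have "inner_prod w (rscale x \<alpha> + rscale y \<beta>) + d
          = inner_prod w x * \<alpha> + inner_prod w y * \<beta> + (d * \<alpha> + d * \<beta>)"
        by (simp add: inner_prod_plus_rscale)
      then show ?thesis by (simp add: distrib_right ac_simps)
    qed
    have "(inner_prod w' x + d') * \<alpha> \<le> (inner_prod w'' x + (d'' + s)) * \<alpha>"
      "(inner_prod w' y + d') * \<beta> \<le> (inner_prod w'' y + (d'' + t)) * \<beta>"
      using le by (simp_all add: u_le[rule_format] times_right_mono)
    then have "(inner_prod w' x + d') * \<alpha> + (inner_prod w' y + d') * \<beta>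
        \<le> (inner_prod w'' x + (d'' + s)) * \<alpha> + (inner_prod w'' y + (d'' + t)) * \<beta>"
      by (rule plus_mono)
    also have "\<dots> = (inner_prod w'' x + d'') * \<alpha> + (inner_prod w'' y + d'') * \<beta> + (s * \<alpha> + t * \<beta>)"
      by (simp add: distrib_right ac_simps)
    finally show ?thesis unfolding u_le[rule_format] affine by (simp flip: affine add: add.assoc)
  qed
  then show ?thesis
    unfolding convex_fun_def convex_wrt_def epigraph_def
    by (auto simp: f_le rscale_pair_def)
qed

text \<open>A level set at height \<open>Elt s\<close> is an intersection of solution sets of affine
  inequalities; at height \<open>Tau\<close> it is the whole space.\<close>

lemma U_convex_imp_lower_semicontinuous:
  fixes f :: "('n::finite \<Rightarrow> 'k::cond_complete_idempotent_semifield) \<Rightarrow> 'k completed"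
  assumes ominus_exists: "\<forall>\<nu> \<kappa>::'k. \<exists>\<mu>. \<kappa> + \<mu> \<ge> \<nu> \<and> (\<forall>\<mu>'. \<kappa> + \<mu>' \<ge> \<nu> \<longrightarrow> \<mu> \<le> \<mu>')"
    and U: "U_convex affine_differences f"
  shows "lower_semicontinuous f"
  unfolding lower_semicontinuous_def
proof
  fix t
  obtain U' where U': "U' \<subseteq> affine_differences" "\<And>x. f x = (SUP u\<in>U'. Elt (u x))"
    using U unfolding U_convex_def by blast
  show "order_closed {x. f x \<le> t}"
  proof (cases t)
    case (Elt s)
    have "order_closed {x. u x \<le> s}" if "u \<in> U'" for u
    proof -
      have "u \<in> affine_differences" using that U'(1) by blast
      from affine_difference_le_iff[OF ominus_exists this] obtain w' w'' d' d'' where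
        "\<forall>x t. u x \<le> t \<longleftrightarrow> inner_prod w' x + d' \<le> inner_prod w'' x + (d'' + t)"
        by (elim exE)
      then show ?thesis
        using order_closed_affine_le[OF linear_if_ominus_exists[OF ominus_exists]] by simp
    qed
    moreover have "{x. f x \<le> t} = (\<Inter>u\<in>U'. {x. u x \<le> s})"
      by (auto simp: Elt U'(2) SUP_le_iff)
    ultimately show ?thesis by (simp add: order_closed_INT)
  qed (simp add: order_closed_def)
qed


section \<open>Separation of a point from the epigraph\<close>

text \<open>In a totally ordered semifield, \<open>1\<close> is either isolated from below, and then belongs to the
  following set, or it is the supremum of the smaller elements, and then the set consists of those. Its
  supremum is \<open>1\<close> in both cases, and its members are reached by any scalar that gets close to \<open>1\<close>.\<close>

definition one_approx :: "'k::idempotent_semiring set" where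
  "one_approx = {b. b \<noteq> 0 \<and> b \<le> 1 \<and> (\<exists>r. r \<noteq> 0 \<and> r < 1 \<and> (\<forall>c. r < c \<longrightarrow> b \<le> c))}"

section \<open>Scalars close to 1 and the cone over the epigraph\<close>

context
  assumes linear: "\<And>a b :: 'k::cond_complete_idempotent_semifield. a \<le> b \<or> b \<le> a"
    and no_top: "\<not> (\<exists>t::'k. \<forall>a. a \<le> t)"
begin

lemmas not_le = not_le_iff_less[OF linear]

text \<open>Without a top, some element lies strictly above 1; its inverse lies strictly
  below.\<close>

lemma exists_between_zero_one: "\<exists>c::'k. c \<noteq> 0 \<and> c < 1"
proof -
  obtain a :: 'k where "\<not> a \<le> 1" using no_top by blast
  then have a: "1 < a" "a \<noteq> 0" using not_le zero_least by auto
  then have "semifield_inv a * 1 \<le> 1" using semifield_inv_times_le_iff[of a 1 1] by simp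
  moreover have "semifield_inv a \<noteq> 1" using a by (metis less_irrefl mult_1_right times_semifield_inv)
  ultimately show ?thesis using a semifield_inv_nonzero by (metis mult_1_right order.not_eq_order_implies_strict)
qed

lemma exists_smaller_nonzero:
  assumes "(a::'k) \<noteq> 0" shows "\<exists>c. c \<noteq> 0 \<and> c < a"
proof -
  obtain c :: 'k where c: "c \<noteq> 0" "c < 1" using exists_between_zero_one by blast
  have "a * c \<noteq> 0" "a * c \<le> a * 1" using assms c times_left_mono[of c 1 a] by (auto simp: mult_eq_zero_iff)
  moreover have "\<not> a * 1 \<le> a * c" using c times_left_le_iff[OF assms] by (metis leD)
  ultimately show ?thesis using not_le by (metis mult_1_right)
qed

text \<open>Left multiplication preserves the supremum of \<open>one_approx\<close>, which is 1.
  This is the limit argument used below whenever \<open>b\<close> tends to 1.\<close>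

lemma one_approx_bound:
  fixes y c :: 'k
  assumes bound: "\<And>b. b \<in> one_approx \<Longrightarrow> y * b \<le> c"
  shows "y \<le> c"
proof -
  let ?B = "one_approx :: 'k set" and ?S = "Sup one_approx :: 'k"
  have less: "b \<in> ?B" if "b \<noteq> 0" "b < 1" for b
    using that unfolding one_approx_def by (auto intro!: exI[of _ b])
  have ne: "?B \<noteq> {}" using exists_between_zero_one less by blast
  have bdd: "bdd_above ?B" by (rule bdd_aboveI[of _ 1]) (simp add: one_approx_def)
  have S: "b \<le> ?S" if "b \<in> ?B" for b using that bdd by (rule cSup_upper)
  have S0: "?S \<noteq> 0" using ne S zero_least unfolding one_approx_def
    by (metis (mono_tags, lifting) equals0I mem_Collect_eq order.antisym)
  have "?S \<le> 1" using ne by (rule cSup_least) (simp add: one_approx_def)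
  moreover have "\<not> ?S < 1"
  \<comment> \<open>Every nonzero element below 1 is in the set. Were the supremum below 1, nothing
    would lie strictly between it and 1, so 1 would belong to the set with the supremum as
    \<open>r\<close>.\<close>
  proof
    assume S1: "?S < 1"
    have "1 \<le> x" if "?S < x" for x
      using that less[of x] S[of x] S0 zero_least not_le by (metis leD)
    with S0 S1 have "\<exists>r. r \<noteq> 0 \<and> r < 1 \<and> (\<forall>c. r < c \<longrightarrow> (1::'k) \<le> c)" by blast
    then have "1 \<in> ?B" by (simp add: one_approx_def)
    then show False using S S1 by (metis leD)
  qed
  ultimately have "?S = 1" by (simp add: order.order_iff_strict)
  then have "y = Sup ((\<lambda>b. y * b) ` ?B)" using mult_cSup_left[OF ne bdd, of y] by simp
  also have "\<dots> \<le> c" using ne bound by (intro cSup_least) auto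
  finally show ?thesis .
qed

text \<open>The inequality for \<open>f\<close> says that \<open>(p, \<mu>, \<gamma>)\<close> lies in the cone over the epigraph of \<open>f\<close>.\<close>

definition scaled_below :: "(('n \<Rightarrow> 'k) \<Rightarrow> 'k completed) \<Rightarrow> 'k \<Rightarrow> ('n \<Rightarrow> 'k) \<Rightarrow> ('n \<Rightarrow> 'k) \<Rightarrow> 'k \<Rightarrow> bool"
  where "scaled_below f \<mu> a p \<gamma> \<longleftrightarrow> \<gamma> \<noteq> 0 \<and> \<gamma> \<le> 1 \<and> p \<le> a \<and>
    f (rscale p (semifield_inv \<gamma>)) \<le> Elt (\<mu> * semifield_inv \<gamma>)"

text \<open>Convexity is used with the coefficients \<open>\<gamma> * s\<close> and
  \<open>\<delta> * s\<close>, which add up to 1. Both points have the same \<open>\<mu>\<close>, so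
  idempotency keeps the height; the bounds by 1 and by \<open>a\<close> survive because sums are
  suprema.\<close>

lemma scaled_below_plus:
  fixes f :: "('n \<Rightarrow> 'k) \<Rightarrow> 'k completed"
  assumes conv: "convex_fun f" and 1: "scaled_below f \<mu> a p \<gamma>" and 2: "scaled_below f \<mu> a q \<delta>"
  shows "scaled_below f \<mu> a (p + q) (\<gamma> + \<delta>)"
proof -
  define s where "s = semifield_inv (\<gamma> + \<delta>)"
  have nz: "\<gamma> \<noteq> 0" "\<delta> \<noteq> 0" "\<gamma> + \<delta> \<noteq> 0" using 1 2 add_eq_zero_iff unfolding scaled_below_def by auto
  have "\<gamma> * s + \<delta> * s = 1" unfolding s_def using nz by (simp flip: distrib_right)
  moreover have "(rscale p (semifield_inv \<gamma>), \<mu> * semifield_inv \<gamma>) \<in> epigraph f"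
    "(rscale q (semifield_inv \<delta>), \<mu> * semifield_inv \<delta>) \<in> epigraph f"
    using 1 2 unfolding scaled_below_def epigraph_def by auto
  ultimately have "rscale_pair (rscale p (semifield_inv \<gamma>), \<mu> * semifield_inv \<gamma>) (\<gamma> * s)
      + rscale_pair (rscale q (semifield_inv \<delta>), \<mu> * semifield_inv \<delta>) (\<delta> * s) \<in> epigraph f"
    using conv unfolding convex_fun_def convex_wrt_def by blast
  moreover have "rscale_pair (rscale p (semifield_inv \<gamma>), \<mu> * semifield_inv \<gamma>) (\<gamma> * s) = (rscale p s, \<mu> * s)"
    "rscale_pair (rscale q (semifield_inv \<delta>), \<mu> * semifield_inv \<delta>) (\<delta> * s) = (rscale q s, \<mu> * s)"
    using nz by (simp_all add: rscale_pair_def rscale_def mult.assoc)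
  moreover have "rscale p s + rscale q s = rscale (p + q) s"
    by (simp add: rscale_def fun_eq_iff distrib_right)
  ultimately have "f (rscale (p + q) s) \<le> Elt (\<mu> * s)"
    by (simp add: epigraph_def add_idem)
  then show ?thesis using nz(3) 1 2 unfolding scaled_below_def s_def[symmetric]
    by (auto simp: plus_le_iff le_fun_def)
qed

context
  fixes f :: "('n::finite \<Rightarrow> 'k) \<Rightarrow> 'k completed" and x0 a :: "'n \<Rightarrow> 'k" and \<mu> :: 'k
  assumes ominus_exists: "\<forall>\<nu> \<kappa>::'k. \<exists>\<mu>. \<kappa> + \<mu> \<ge> \<nu> \<and> (\<forall>\<mu>'. \<kappa> + \<mu>' \<ge> \<nu> \<longrightarrow> \<mu> \<le> \<mu>')"
    and minorant_le: "\<forall>u\<in>affine_differences. (\<forall>x. Elt (u x) \<le> f x) \<longrightarrow> u x0 \<le> \<mu>"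
    and \<mu>: "\<mu> \<noteq> 0"
    and a: "x0 \<le> a" "\<forall>i. a i \<noteq> 0"
begin

text \<open>The difference with minuend \<open>A\<close> and subtrahend \<open>\<mu> (\<langle>a\<^sup>-\<^sup>1, x\<rangle> \<oplus> 1)\<close> exceeds \<open>\<mu>\<close> at \<open>x0\<close>, hence is not
  a minorant of \<open>f\<close>. A point of the epigraph where it fails, normalised so as to satisfy the
  constraints of \<open>scaled_below\<close> tightly, is large in the direction of \<open>A\<close>.\<close>

lemma exists_scaled_below:
  assumes A: "A = (\<lambda>x. inner_prod w x + d)" and large: "\<mu> < A x0"
  shows "\<exists>x \<gamma>. scaled_below f \<mu> a (rscale x \<gamma>) \<gamma> \<and> \<mu> < A x * \<gamma>"
proof -
  \<comment> \<open>The coefficients exist because each \<open>a i\<close> is invertible, and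
    \<open>x0 \<le> a\<close> keeps the subtrahend at \<open>x0\<close> at most
    \<open>\<mu>\<close>.\<close>
  define w'' where "w'' = (\<lambda>i. \<mu> * semifield_inv (a i))"
  define u where "u = (\<lambda>x. A x \<ominus> (inner_prod w'' x + \<mu>))"
  have u_le: "u x \<le> t \<longleftrightarrow> A x \<le> inner_prod w'' x + \<mu> + t" for x t
    unfolding u_def by (rule ominus_le_iff[OF ominus_exists])
  have U: "u \<in> affine_differences" unfolding u_def A affine_differences_def by blast
  have "inner_prod w'' x0 \<le> \<mu>"
  proof -
    have "\<mu> * semifield_inv (a i) * x0 i \<le> \<mu>" for i
    proof -
      have "semifield_inv (a i) * x0 i \<le> 1"
        using a semifield_inv_times_le_iff[of "a i" "x0 i" 1] by (simp add: le_fun_def)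
      then show ?thesis using times_left_mono by (metis mult.assoc mult_1_right)
    qed
    then show ?thesis by (simp add: inner_prod_def w''_def sum_le_iff)
  qed
  then have "inner_prod w'' x0 + \<mu> + \<mu> \<le> \<mu>" by (simp add: plus_le_iff)
  then have "\<not> u x0 \<le> \<mu>" unfolding u_le using large by (meson leD order_trans)
  then obtain x where "\<not> Elt (u x) \<le> f x" using minorant_le U by blast
  then obtain t where t: "f x = Elt t" "\<not> u x \<le> t" by (cases "f x") auto
  define M where "M = inner_prod w'' x + \<mu> + t"
  have M: "M < A x" using t(2) not_le unfolding u_le M_def by blast
  have part: "inner_prod w'' x \<le> M" "\<mu> \<le> M" "t \<le> M"
    using order_refl[of M] unfolding M_def plus_le_iff by auto
  have M0: "M \<noteq> 0" using part(2) \<mu> zero_least by (metis order.antisym)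
  \<comment> \<open>Chosen so that \<open>M * \<gamma> = \<mu>\<close>: scaling by
    \<open>\<gamma>\<close> turns the three parts of \<open>M\<close> into
    \<open>rscale x \<gamma> \<le> a\<close>, \<open>\<gamma> \<le> 1\<close> and
    \<open>t * \<gamma> \<le> \<mu>\<close>, and \<open>M < A x\<close> into
    \<open>\<mu> < A x * \<gamma>\<close>.\<close>
  define \<gamma> where "\<gamma> = semifield_inv M * \<mu>"
  have \<gamma>0: "\<gamma> \<noteq> 0" unfolding \<gamma>_def using M0 \<mu> by (simp add: mult_eq_zero_iff semifield_inv_nonzero)
  have M\<gamma>: "M * \<gamma> = \<mu>" unfolding \<gamma>_def using M0 by simp
  have "\<mu> * \<gamma> \<le> \<mu> * 1" using times_right_mono[OF part(2), of \<gamma>] M\<gamma> by simp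
  then have \<gamma>1: "\<gamma> \<le> 1" using times_left_le_iff[OF \<mu>] by blast
  have "x i * \<gamma> \<le> a i" for i
  proof -
    have "w'' i * x i \<le> M" using part(1) by (simp add: inner_prod_def sum_le_iff)
    then have "\<mu> * (semifield_inv (a i) * (x i * \<gamma>)) \<le> \<mu> * 1"
      using times_right_mono[of "w'' i * x i" M \<gamma>] M\<gamma> by (simp add: w''_def mult.assoc)
    then have "semifield_inv (a i) * (x i * \<gamma>) \<le> 1" using times_left_le_iff[OF \<mu>] by blast
    then show ?thesis using semifield_inv_times_le_iff[OF a(2)[rule_format]] by (metis mult_1_right)
  qed
  then have le_a: "rscale x \<gamma> \<le> a" by (simp add: rscale_def le_fun_def)
  have "t * \<gamma> \<le> \<mu>" using times_right_mono[OF part(3), of \<gamma>] M\<gamma> by simp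
  then have "f x \<le> Elt (\<mu> * semifield_inv \<gamma>)" using t(1) \<gamma>0 by (simp add: le_times_semifield_inv_iff)
  moreover have "rscale (rscale x \<gamma>) (semifield_inv \<gamma>) = x" using \<gamma>0 by (simp add: rscale_def)
  ultimately have "scaled_below f \<mu> a (rscale x \<gamma>) \<gamma>"
    unfolding scaled_below_def using \<gamma>0 \<gamma>1 le_a by simp
  moreover have "\<mu> < A x * \<gamma>" using M M\<gamma> times_right_le_iff[OF \<gamma>0] by (metis not_le)
  ultimately show ?thesis by blast
qed

text \<open>One point per nonzero coordinate of \<open>x0\<close> and one with large
  \<open>\<gamma>\<close> are added up; the sum dominates each of them. Exceeding the
  \<open>r\<close> from \<open>one_approx\<close> upgrades to being at least
  \<open>b\<close>.\<close>

lemma exists_scaled_below_approx: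
  assumes conv: "convex_fun f" and b: "b \<in> one_approx"
  shows "\<exists>p \<gamma>. scaled_below f \<mu> a p \<gamma> \<and> b \<le> \<gamma> \<and> rscale x0 b \<le> p"
proof -
  obtain r where r: "r \<noteq> 0" "r < 1" "\<And>c. r < c \<Longrightarrow> b \<le> c" using b unfolding one_approx_def by blast
  \<comment> \<open>The minuends below carry the factor \<open>\<mu> * semifield_inv s\<close>, so
    exceeding \<open>\<mu>\<close> means exceeding the threshold \<open>s\<close>.\<close>
  have above: "\<mu> < \<mu> * semifield_inv s * c \<longleftrightarrow> s < c" if "s \<noteq> 0" for s c
  proof -
    have "\<mu> * (semifield_inv s * c) \<le> \<mu> * 1 \<longleftrightarrow> c \<le> s"
      unfolding times_left_le_iff[OF \<mu>] using semifield_inv_times_le_iff[OF that, of c 1] by simp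
    then show ?thesis by (metis not_le mult.assoc mult_1_right)
  qed
  have coord: "\<exists>p \<gamma>. scaled_below f \<mu> a p \<gamma> \<and> x0 j * b \<le> p j" if j: "x0 j \<noteq> 0" for j
  proof -
    \<comment> \<open>The minuend sees only coordinate \<open>j\<close>, with threshold
      \<open>x0 j * r\<close>; as \<open>r < 1\<close>, \<open>x0\<close> itself passes it.\<close>
    define w where "w = (\<lambda>i. if i = j then \<mu> * semifield_inv (x0 j * r) else 0)"
    have ip: "inner_prod w x = \<mu> * semifield_inv (x0 j * r) * x j" for x
      by (simp add: inner_prod_def w_def if_distrib[of "\<lambda>z. z * _"] cong: if_cong)
    have nz: "x0 j * r \<noteq> 0" using j r by (simp add: mult_eq_zero_iff)
    have "x0 j * r < x0 j" using times_left_le_iff[OF j] r(2) by (metis mult_1_right not_le)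
    then have "\<mu> < inner_prod w x0 + 0" using above[OF nz] by (simp add: ip)
    from exists_scaled_below[OF refl this] obtain x \<gamma>
      where x: "scaled_below f \<mu> a (rscale x \<gamma>) \<gamma>" "\<mu> < \<mu> * semifield_inv (x0 j * r) * (x j * \<gamma>)"
      by (auto simp: ip mult.assoc)
    then have "\<not> x j * \<gamma> \<le> x0 j * r" using above[OF nz] by (metis leD)
    then have "r < semifield_inv (x0 j) * (x j * \<gamma>)"
      using semifield_inv_times_le_iff[OF j] not_le by blast
    then have "x0 j * b \<le> x j * \<gamma>" using r(3) le_semifield_inv_times_iff[OF j] by blast
    then show ?thesis using x(1) by (auto simp: rscale_def)
  qed
  have "\<exists>p \<gamma>. scaled_below f \<mu> a p \<gamma> \<and> b \<le> \<gamma> \<and> (\<forall>j\<in>J. x0 j * b \<le> p j)" if "finite J" for J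
    using that
  proof (induction J)
    \<comment> \<open>A constant minuend with threshold \<open>r\<close> gives a point with
      \<open>b \<le> \<gamma>\<close>; later summands can only raise
      \<open>\<gamma>\<close>.\<close>
    case empty
    have ip: "inner_prod (\<lambda>_. 0) x = 0" for x :: "'n \<Rightarrow> 'k" by (simp add: inner_prod_def)
    have "\<mu> < inner_prod (\<lambda>_. 0) x0 + \<mu> * semifield_inv r" using above[OF r(1), of 1] r by (simp add: ip)
    from exists_scaled_below[OF refl this] obtain x \<gamma>
      where "scaled_below f \<mu> a (rscale x \<gamma>) \<gamma>" "\<mu> < \<mu> * semifield_inv r * \<gamma>"
      by (auto simp: ip)
    then show ?case using above r by blast
  next
    case (insert j J)
    then obtain p \<gamma> where p: "scaled_below f \<mu> a p \<gamma>" "b \<le> \<gamma>" "\<forall>j\<in>J. x0 j * b \<le> p j" by blast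
    show ?case
    proof (cases "x0 j = 0")
      case True
      then show ?thesis using p zero_least by (auto intro!: exI[of _ p] exI[of _ \<gamma>])
    next
      case False
      then obtain q \<delta> where q: "scaled_below f \<mu> a q \<delta>" "x0 j * b \<le> q j" using coord by blast
      have "b \<le> \<gamma> + \<delta>" "\<forall>j\<in>insert j J. x0 j * b \<le> (p + q) j"
        using p(2,3) q(2) by (auto intro: plus_upperI)
      then show ?thesis using scaled_below_plus[OF conv p(1) q(1)] by blast
    qed
  qed
  from this[OF finite_UNIV] show ?thesis by (simp add: le_fun_def rscale_def)
qed

end

text \<open>For each \<open>b0\<close> in \<open>one_approx\<close>, \<open>x0\<close> is squeezed
  into the closed level set at \<open>\<mu> * ?inv b0\<close> by normalised points from
  \<open>exists_scaled_below_approx\<close>. Letting \<open>b0\<close> tend to 1 gives the level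
  \<open>\<mu>\<close>.\<close>

lemma le_if_minorants_le:
  fixes f :: "('n::finite \<Rightarrow> 'k) \<Rightarrow> 'k completed"
  assumes ominus_exists: "\<forall>\<nu> \<kappa>::'k. \<exists>\<mu>. \<kappa> + \<mu> \<ge> \<nu> \<and> (\<forall>\<mu>'. \<kappa> + \<mu>' \<ge> \<nu> \<longrightarrow> \<mu> \<le> \<mu>')"
    and minorant_le: "\<forall>u\<in>affine_differences. (\<forall>x. Elt (u x) \<le> f x) \<longrightarrow> u x0 \<le> \<mu>"
    and \<mu>: "\<mu> \<noteq> 0" and conv: "convex_fun f" and lsc: "lower_semicontinuous f"
  shows "f x0 \<le> Elt \<mu>"
proof -
  let ?inv = "semifield_inv :: 'k \<Rightarrow> 'k"
  have approx_plus: "b + b' \<in> one_approx" if "b \<in> one_approx" "b' \<in> one_approx" for b b' :: 'k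
    using that linear[of b b'] by (auto simp: natural_le add.commute[of b b'])
  have approx: "b \<noteq> 0" "b \<le> 1" if "b \<in> one_approx" for b :: 'k
    using that unfolding one_approx_def by auto
  have le_b0: "f x0 \<le> Elt (\<mu> * ?inv b0)" if b0: "b0 \<in> one_approx" for b0
  proof -
    \<comment> \<open>This bounds \<open>p i * ?inv \<gamma>\<close> when
      \<open>p i \<le> x0 i + e\<close> and \<open>b + b0 \<le> \<gamma>\<close>. The summand
      \<open>b0\<close> keeps all of \<open>Hi\<close> below \<open>(x0 i + 1) * ?inv b0\<close>, as
      a net has to be bounded.\<close>
    define hi where "hi b e = (\<lambda>i. (x0 i + e) * ?inv (b + b0))" for b e
    define Lo where "Lo = (\<lambda>b. rscale x0 b) ` one_approx"
    define Hi where "Hi = {hi b e | b e. b \<in> one_approx \<and> e \<noteq> 0 \<and> e \<le> 1}"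
    have hi_iff: "y \<le> hi b e \<longleftrightarrow> (\<forall>i. y i * (b + b0) \<le> x0 i + e)" if "b \<in> one_approx" for y b e
      unfolding hi_def le_fun_def
      using approx(1)[OF approx_plus[OF that b0]] by (simp add: le_times_semifield_inv_iff)
    have x_hi: "x0 \<le> hi b e" if "b \<in> one_approx" for b e
    proof -
      have "x0 i * (b + b0) \<le> x0 i" for i
        using approx(2)[OF approx_plus[OF that b0]] times_left_mono by (metis mult_1_right)
      then show ?thesis unfolding hi_iff[OF that] by (simp add: plus_upperI)
    qed
    have hi_mono: "hi b e \<le> hi b' e'" if "b' \<in> one_approx" "b' \<le> b" "e \<le> e'" for b b' e e'
    proof -
      have "b' + b0 \<le> b + b0" using that(2) by (simp add: plus_mono)
      then have "?inv (b + b0) \<le> ?inv (b' + b0)"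
        using approx(1)[OF approx_plus[OF that(1) b0]] by (rule semifield_inv_antimono[rotated])
      moreover have "x0 i + e \<le> x0 i + e'" for i
        using that(3) by (simp add: plus_mono)
      ultimately show ?thesis unfolding hi_def le_fun_def by (simp add: times_mono)
    qed
    have "x0 \<in> {x. f x \<le> Elt (\<mu> * ?inv b0)}"
    proof (rule order_closed_squeeze[of _ Lo _ Hi])
      show "order_closed {x. f x \<le> Elt (\<mu> * ?inv b0)}"
        using lsc unfolding lower_semicontinuous_def by blast
      show "Lo \<noteq> {}" using b0 unfolding Lo_def by blast
      have "hi b0 1 \<in> Hi" unfolding Hi_def using b0 zero_neq_one order_refl by fastforce
      then show "Hi \<noteq> {}" by blast
      show "bdd_below Lo"
        by (rule bdd_belowI[of _ "\<lambda>_. 0"]) (auto simp: le_fun_def zero_least)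
      show "bdd_above Hi"
      proof (rule bdd_aboveI[of _ "\<lambda>i. (x0 i + 1) * ?inv b0"])
        fix h assume "h \<in> Hi"
        then obtain b e where be: "h = hi b e" "b \<in> one_approx" "e \<le> 1" unfolding Hi_def by blast
        have "?inv (b + b0) \<le> ?inv b0" using approx[OF b0] by (intro semifield_inv_antimono) auto
        moreover have "x0 i + e \<le> x0 i + 1" for i
          using be(3) by (simp add: plus_mono)
        ultimately show "h \<le> (\<lambda>i. (x0 i + 1) * ?inv b0)" unfolding be hi_def le_fun_def by (simp add: times_mono)
      qed
      show "\<exists>k\<in>Lo. l \<le> k \<and> m \<le> k" if lm: "l \<in> Lo" "m \<in> Lo" for l m
      proof -
        obtain b b' where b: "b \<in> one_approx" "b' \<in> one_approx" "l = rscale x0 b" "m = rscale x0 b'"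
          using lm by (auto simp: Lo_def)
        have "rscale x0 (b + b') \<in> Lo" unfolding Lo_def using approx_plus b by blast
        then show ?thesis unfolding b
          by (rule rev_bexI) (simp add: rscale_def le_fun_def times_left_mono)
      qed
      show "\<exists>k\<in>Hi. k \<le> l \<and> k \<le> m" if lm: "l \<in> Hi" "m \<in> Hi" for l m
      proof -
        obtain b e b' e' where b: "b \<in> one_approx" "b' \<in> one_approx" "l = hi b e" "m = hi b' e'"
          and e: "e \<noteq> 0" "e \<le> 1" "e' \<noteq> 0" "e' \<le> 1"
          using lm unfolding Hi_def by blast
        obtain e'' where e'': "e'' \<le> e" "e'' \<le> e'" "e'' \<noteq> 0" using linear[of e e'] e by blast
        have "e'' \<le> 1" using e''(1) e(2) by (rule order_trans)
        then have "hi (b + b') e'' \<in> Hi" unfolding Hi_def using approx_plus b(1,2) e''(3) by blast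
        then show ?thesis using hi_mono b e'' by (intro bexI[of _ "hi (b + b') e''"]) auto
      qed
      show "l \<le> x0" if "l \<in> Lo" for l
        using that approx(2) times_left_mono[of _ 1] by (fastforce simp: Lo_def rscale_def le_fun_def)
      show "x0 \<le> h" if "h \<in> Hi" for h using that x_hi unfolding Hi_def by blast
      show "x0 \<le> y" if y: "\<And>l. l \<in> Lo \<Longrightarrow> l \<le> y" for y
        unfolding le_fun_def
      proof
        fix i
        show "x0 i \<le> y i"
          by (rule one_approx_bound) (use y in \<open>auto simp: Lo_def rscale_def le_fun_def\<close>)
      qed
      show "y \<le> x0" if y: "\<And>h. h \<in> Hi \<Longrightarrow> y \<le> h" for y
        unfolding le_fun_def
      proof
        fix i
        have ye: "y i \<le> x0 i + e" if e: "e \<noteq> 0" "e \<le> 1" for e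
        proof (rule one_approx_bound)
          fix b :: 'k assume b: "b \<in> one_approx"
          have "hi b e \<in> Hi" using b e unfolding Hi_def by blast
          then have "y i * (b + b0) \<le> x0 i + e" using y hi_iff[OF b] by blast
          moreover have "y i * b \<le> y i * (b + b0)" by (simp add: times_left_mono)
          ultimately show "y i * b \<le> x0 i + e" by (rule order_trans[rotated])
        qed
        show "y i \<le> x0 i"
        proof (rule ccontr)
          assume "\<not> y i \<le> x0 i"
          then have lt: "x0 i < y i" by (simp add: not_le)
          then have "y i \<noteq> 0" using zero_least by (metis leD)
          \<comment> \<open>There are nonzero elements below \<open>y i\<close>, so a small enough
            perturbation stays strictly below \<open>y i\<close>, also where
            \<open>x0 i = 0\<close>.\<close>
          then obtain e where e: "e \<noteq> 0" "e < y i" using exists_smaller_nonzero by blast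
          obtain e' where "e' \<noteq> 0" "e' \<le> 1" "e' \<le> e"
            using linear[of e 1] e(1) by (metis order_refl zero_neq_one)
          then have "y i \<le> x0 i + e'" "x0 i + e' < y i"
            using ye lt e(2) plus_less_iff[OF linear] by auto
          then show False by simp
        qed
      qed
      show "\<exists>q\<in>{x. f x \<le> Elt (\<mu> * ?inv b0)}. l \<le> q \<and> q \<le> h" if lh: "l \<in> Lo" "h \<in> Hi" for l h
      proof -
        obtain b b' e where b: "b \<in> one_approx" "b' \<in> one_approx" "l = rscale x0 b" "h = hi b' e" "e \<noteq> 0"
          using lh unfolding Lo_def Hi_def by blast
        \<comment> \<open>Adding \<open>e\<close> makes every coordinate invertible, also those
          where \<open>x0\<close> vanishes.\<close>
        define a where "a = (\<lambda>i. x0 i + e)"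
        have a: "x0 \<le> a" "\<forall>i. a i \<noteq> 0" unfolding a_def using b(5) add_eq_zero_iff by (auto simp: le_fun_def)
        \<comment> \<open>One parameter serves three purposes: \<open>b\<close> for the lower end
          \<open>l\<close>, \<open>b' + b0\<close> for the upper end \<open>h\<close>, and
          \<open>b0\<close> for the level.\<close>
        have "b + (b' + b0) \<in> one_approx" using approx_plus b b0 by blast
        from exists_scaled_below_approx[OF ominus_exists minorant_le \<mu> a conv this]
        obtain p \<gamma> where p: "scaled_below f \<mu> a p \<gamma>" "b + (b' + b0) \<le> \<gamma>"
          "rscale x0 (b + (b' + b0)) \<le> p"
          by blast
        define q where "q = rscale p (?inv \<gamma>)"
        have \<gamma>: "\<gamma> \<noteq> 0" "\<gamma> \<le> 1" "p \<le> a" "f q \<le> Elt (\<mu> * ?inv \<gamma>)"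
          using p(1) unfolding scaled_below_def q_def by auto
        have ge: "b' + b0 \<le> \<gamma>" "b0 \<le> \<gamma>" using p(2) by (simp_all add: plus_le_iff)
        then have inv: "?inv \<gamma> \<le> ?inv (b' + b0)" "?inv \<gamma> \<le> ?inv b0"
          using approx(1) approx_plus b b0 by (auto intro: semifield_inv_antimono)
        have "f q \<le> Elt (\<mu> * ?inv b0)"
          using \<gamma>(4) by (rule order_trans) (simp add: inv(2) times_left_mono)
        moreover have "l \<le> q"
          unfolding le_fun_def
        proof
          fix i
          have "x0 i * b \<le> x0 i * (b + (b' + b0))" by (simp add: times_left_mono)
          also have "\<dots> \<le> p i" using p(3) by (simp add: le_fun_def rscale_def)
          also have "p i * 1 \<le> p i * ?inv \<gamma>"
            using \<gamma> le_times_semifield_inv_iff[of \<gamma> 1 1] by (intro times_left_mono) simp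
          finally show "l i \<le> q i" by (simp add: b rscale_def q_def)
        qed
        moreover have "q \<le> h"
          unfolding q_def b hi_def rscale_def le_fun_def
          using \<gamma>(3) inv(1) unfolding le_fun_def a_def by (simp add: times_mono)
        ultimately show ?thesis by blast
      qed
    qed
    then show ?thesis by simp
  qed
  \<comment> \<open>Were the set empty, the premise of \<open>one_approx_bound\<close> would hold
    vacuously and every element would be a top.\<close>
  have "one_approx \<noteq> ({} :: 'k set)" using one_approx_bound no_top by (metis empty_iff)
  then obtain t where t: "f x0 = Elt t" using le_b0 by (cases "f x0") auto
  have "t \<le> \<mu>"
    by (rule one_approx_bound) (use le_b0 approx(1) in \<open>simp add: t le_times_semifield_inv_iff\<close>)
  then show ?thesis by (simp add: t)
qed

text \<open>The supremum of all minorants in \<open>affine_differences\<close> recovers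
  \<open>f\<close>: where it has a nonzero value \<open>s\<close> in the semifield,
  \<open>le_if_minorants_le\<close> bounds \<open>f x\<close> by \<open>s\<close>; where it is
  \<open>Tau\<close>, nothing is left to prove.\<close>

lemma convex_lsc_imp_U_convex:
  fixes f :: "('n::finite \<Rightarrow> 'k) \<Rightarrow> 'k completed"
  assumes ominus_exists: "\<forall>\<nu> \<kappa>::'k. \<exists>\<mu>. \<kappa> + \<mu> \<ge> \<nu> \<and> (\<forall>\<mu>'. \<kappa> + \<mu>' \<ge> \<nu> \<longrightarrow> \<mu> \<le> \<mu>')"
    and conv: "convex_fun f" and lsc: "lower_semicontinuous f"
  shows "U_convex affine_differences f"
proof -
  define U' where "U' = {u \<in> affine_differences. \<forall>x. Elt (u x) \<le> f x}"
  have "f x = (SUP u\<in>U'. Elt (u x))" for x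
  proof (rule order.antisym)
    show "(SUP u\<in>U'. Elt (u x)) \<le> f x" by (rule SUP_least) (simp add: U'_def)
    show "f x \<le> (SUP u\<in>U'. Elt (u x))"
    proof (cases "SUP u\<in>U'. Elt (u x)")
      case (Elt s)
      have us: "u x \<le> s" if "u \<in> U'" for u
        using SUP_upper[OF that, of "\<lambda>u. Elt (u x)"] Elt by simp
      have le: "f x \<le> Elt \<mu>" if "\<mu> \<noteq> 0" "s \<le> \<mu>" for \<mu>
        by (rule le_if_minorants_le[OF ominus_exists _ that(1) conv lsc])
          (use us that(2) in \<open>auto simp: U'_def intro: order_trans\<close>)
      show ?thesis
      proof (cases "s = 0")
        \<comment> \<open>\<open>le_if_minorants_le\<close> takes a nonzero bound. For
          \<open>s = 0\<close> it applies to every nonzero \<open>\<mu>\<close>, and below each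
          nonzero element there is a smaller one.\<close>
        case True
        obtain t where t: "f x = Elt t" using le[of 1] True zero_least zero_neq_one by (cases "f x") auto
        have "t = 0"
        proof (rule ccontr)
          assume "t \<noteq> 0"
          then obtain c where "c \<noteq> 0" "c < t" using exists_smaller_nonzero by blast
          moreover have "t \<le> c" using le[of c] True t \<open>c \<noteq> 0\<close> by (simp add: zero_least)
          ultimately show False by simp
        qed
        then show ?thesis by (simp add: t Elt zero_least)
      qed (simp add: Elt le)
    qed simp
  qed
  moreover have "U' \<subseteq> affine_differences" unfolding U'_def by blast
  ultimately show ?thesis unfolding U_convex_def by (intro exI[of _ U'] conjI allI)
qed

end

theorem theorem4p8:
  fixes f :: "('n::finite \<Rightarrow> 'k::cond_complete_idempotent_semifield) \<Rightarrow> 'k completed"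
  assumes no_top: "\<not> (\<exists>t::'k. \<forall>a. a \<le> t)"
    and ominus_exists: "\<forall>\<nu> \<kappa>::'k. \<exists>\<mu>. \<kappa> + \<mu> \<ge> \<nu> \<and> (\<forall>\<mu>'. \<kappa> + \<mu>' \<ge> \<nu> \<longrightarrow> \<mu> \<le> \<mu>')"
  shows "convex_fun f \<and> lower_semicontinuous f \<longleftrightarrow> U_convex affine_differences f"
  using convex_lsc_imp_U_convex[OF linear_if_ominus_exists[OF ominus_exists] no_top ominus_exists]
    U_convex_imp_convex_fun[OF ominus_exists] U_convex_imp_lower_semicontinuous[OF ominus_exists]
  by blast

end
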